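(* Let $1<p<q<\infty$ and let $\omega$ be a discrete weight on $\mathbb{Z}$. (i) If $\omega\in\mathcal{A}_p(\mathbb{Z})$, then $\mathcal{M}$ is bounded from $l^p_{q\,(\omega)}$ to $l^p_{q\,(\omega)}$. (ii) If $\mathcal{M}$ is bounded from $l^p_{q\,(\omega)}$ to $l^p_{q\,(\omega)}$, then $\omega\in\mathcal{A}_q(\mathbb{Z})$.
   Context: A discrete weight on $\mathbb{Z}$ is a sequence $\omega=\{\omega(k)\}_{k\in\mathbb{Z}}$ of positive real numbers; for a finite set $S\subset\mathbb{Z}$, $\omega(S):=\sum_{k\in S}\omega(k)$. Let $\mathbb{N}=\{0,1,2,\dots\}$ and, for $m\in\mathbb{Z}$, $N\in\mathbb{N}$, $S_{m,N}:=\{k\in\mathbb{Z}:|k-m|\le N\}$, so $|S_{m,N}|=2N+1$. An interval $J\subset\mathbb{Z}$ is a nonempty finite set of consecutive integers, and $|J|$ is its cardinality. For $1<r<\infty$, $\omega\in\mathcal{A}_r(\mathbb{Z})$ means $$\sup_{J}\Big(\frac1{|J|}\sum_{k\in J}\omega(k)\Big)\Big(\frac1{|J|}\sum_{k\in J}\omega(k)^{-\frac1{r-1}}\Big)^{r-1}<\infty,$$ the supremum being over all intervals $J\subset\mathbb{Z}$. The discrete weighted Morrey space $l^p_{q\,(\omega)}$ is the set of real sequences $x=\{x(k)\}_{k\in\mathbb{Z}}$ with $$\|x\|_{l^p_{q\,(\omega)}}:=\sup_{m\in\mathbb{Z},N\in\mathbb{N}}\omega(S_{m,N})^{\frac1q-\frac1p}\Big(\sum_{k\in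 S_{m,N}}|x(k)|^p\omega(k)\Big)^{1/p}<\infty.$$ The discrete Hardy–Littlewood maximal operator is $\mathcal{M}x(m):=\sup_{N\in\mathbb{N}}\frac1{|S_{m,N}|}\sum_{k\in S_{m,N}}|x(k)|$, $m\in\mathbb{Z}$. "$\mathcal{M}$ is bounded from $X$ to $Y$" means there is a constant $C>0$ such that for all $x\in X$, $\mathcal{M}x\in Y$ and $\|\mathcal{M}x\|_Y\le C\|x\|_X$. *)

theory Defs
  imports Complex_Main "HOL-Library.Extended_Nonnegative_Real"
begin

text \<open>
  All suprema are taken in \<^typ>\<open>ennreal\<close>, so that a supremum is infinite exactly when
  the family is unbounded; every real number embedded by \<^const>\<open>ennreal\<close> below is
  nonnegative when \<open>\<omega>\<close> is positive.
\<close>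

definition discrete_weight :: "(int \<Rightarrow> real) \<Rightarrow> bool" where
  "discrete_weight \<omega> \<longleftrightarrow> (\<forall>k. \<omega> k > 0)"

definition symm_interval :: "int \<Rightarrow> nat \<Rightarrow> int set" where
  "symm_interval m N = {k. \<bar>k - m\<bar> \<le> int N}"

definition intervals :: "int set set" where
  "intervals = {{a..b} | a b. a \<le> b}"

text \<open>The Muckenhoupt class \<open>A\<^sub>r\<close>; meaningful for \<open>r > 1\<close> and positive \<open>\<omega>\<close>.\<close>

definition muckenhoupt :: "real \<Rightarrow> (int \<Rightarrow> real) set" where
  "muckenhoupt r = {\<omega>.
     (SUP J\<in>intervals. ennreal
        ((1 / real (card J) * (\<Sum>k\<in>J. \<omega> k)) *
         (1 / real (card J) * (\<Sum>k\<in>J. \<omega> k powr (- 1 / (r - 1)))) powr (r - 1))) < \<infinity>}"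

definition morrey_norm :: "real \<Rightarrow> real \<Rightarrow> (int \<Rightarrow> real) \<Rightarrow> (int \<Rightarrow> real) \<Rightarrow> ennreal" where
  "morrey_norm p q \<omega> x =
     (SUP (m, N) \<in> (UNIV :: (int \<times> nat) set). ennreal
        ((\<Sum>k\<in>symm_interval m N. \<omega> k) powr (1 / q - 1 / p) *
         (\<Sum>k\<in>symm_interval m N. \<bar>x k\<bar> powr p * \<omega> k) powr (1 / p)))"

definition morrey_space :: "real \<Rightarrow> real \<Rightarrow> (int \<Rightarrow> real) \<Rightarrow> (int \<Rightarrow> real) set" where
  "morrey_space p q \<omega> = {x. morrey_norm p q \<omega> x < \<infinity>}"

definition maximal_op :: "(int \<Rightarrow> real) \<Rightarrow> int \<Rightarrow> ennreal" where
  "maximal_op x m =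
     (SUP N. ennreal (1 / real (card (symm_interval m N)) * (\<Sum>k\<in>symm_interval m N. \<bar>x k\<bar>)))"

text \<open>
  The operator \<open>T\<close> may take the value \<open>\<infinity>\<close>, whereas the elements of \<open>Y\<close> are real
  sequences. Hence \<open>T x \<in> Y\<close> requires \<open>T x\<close> to be finite at every point; without this
  clause \<^const>\<open>enn2real\<close> would silently replace \<open>\<infinity>\<close> by \<open>0\<close>.
\<close>

definition bounded_from_to ::
  "((int \<Rightarrow> real) \<Rightarrow> int \<Rightarrow> ennreal) \<Rightarrow>
   (int \<Rightarrow> real) set \<Rightarrow> ((int \<Rightarrow> real) \<Rightarrow> ennreal) \<Rightarrow>
   (int \<Rightarrow> real) set \<Rightarrow> ((int \<Rightarrow> real) \<Rightarrow> ennreal) \<Rightarrow> bool" where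
  "bounded_from_to T X normX Y normY \<longleftrightarrow>
     (\<exists>C::real. C > 0 \<and> (\<forall>x\<in>X.
        (\<forall>m. T x m < \<infinity>) \<and>
        (\<lambda>m. enn2real (T x m)) \<in> Y \<and>
        normY (\<lambda>m. enn2real (T x m)) \<le> ennreal C * normX x))"

end

theory Submission
  imports Defs "HOL-Analysis.Analysis"
begin

text \<open>
  (i) The uncentred maximal function with respect to an arbitrary positive weight \<open>\<mu>\<close> on \<open>\<int>\<close>
  is bounded on \<open>l\<^sup>p(\<mu>)\<close> with a constant depending only on \<open>p\<close>: it is dominated by a left-sided
  and a right-sided maximal function, and these obey the rising sun inequality. For
  \<open>\<omega> \<in> A\<^sub>p\<close> and \<open>\<sigma> = \<omega> powr (- 1 / (p - 1))\<close>, Lerner's pointwise bound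
  \<open>(M f)\<^sup>p\<^sup>-\<^sup>1 \<le> D M\<^sub>\<omega> ((M\<^sub>\<sigma> (f / \<sigma>))\<^sup>p\<^sup>-\<^sup>1 / \<omega>)\<close> then gives Muckenhoupt's theorem on \<open>l\<^sup>p(\<omega>)\<close>, uniformly
  over finite windows. On \<open>S = S\<^sub>m\<^sub>,\<^sub>N\<close>, averages of radius at most \<open>N\<close> only see the doubled
  window and are controlled by this and by doubling; an average of larger radius is, by the
  \<open>A\<^sub>p\<close> condition, at most a constant times \<open>\<omega>(S) powr (- 1 / q) * \<parallel>x\<parallel>\<close>.

  (ii) By Jensen's inequality the Morrey norm is at most the \<open>l\<^sup>q(\<omega>)\<close> norm. Testing the
  boundedness on \<open>\<omega> powr (- 1 / (q - 1))\<close> restricted to an interval gives \<open>A\<^sub>q\<close>.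
\<close>

section \<open>Elementary inequalities for real powers\<close>

lemma powr_add_le:
  fixes a b p :: real
  assumes "0 \<le> a" "0 \<le> b" "0 \<le> p"
  shows "(a + b) powr p \<le> 2 powr p * (a powr p + b powr p)"
proof -
  have "(a + b) powr p \<le> (2 * max a b) powr p"
    using assms by (intro powr_mono2) auto
  also have "\<dots> = 2 powr p * (max a b) powr p"
    using assms by (simp add: powr_mult)
  also have "\<dots> \<le> 2 powr p * (a powr p + b powr p)"
    by (intro mult_left_mono) (auto simp: max_def)
  finally show ?thesis .
qed

text \<open>Jensen's inequality for the \<open>p\<close>-th power, cleared of denominators. The
  tangent at the weighted mean \<open>t\<close> lies below the power function, and its linear term
  sums to zero against \<mu>.\<close>

lemma powr_sum_le_sum_powr:
  fixes g \<mu> :: "'a \<Rightarrow> real"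
  assumes p: "1 < p" and J: "finite J" "J \<noteq> {}"
    and \<mu>: "\<And>k. k \<in> J \<Longrightarrow> 0 < \<mu> k" and g: "\<And>k. k \<in> J \<Longrightarrow> 0 \<le> g k"
  shows "(\<Sum>k\<in>J. g k * \<mu> k) powr p \<le> (\<Sum>k\<in>J. \<mu> k) powr (p - 1) * (\<Sum>k\<in>J. g k powr p * \<mu> k)"
proof -
  define V where "V = (\<Sum>k\<in>J. \<mu> k)"
  define t where "t = (\<Sum>k\<in>J. g k * \<mu> k) / V"
  have V: "V > 0" unfolding V_def using J \<mu> by (intro sum_pos) auto
  have gt: "(\<Sum>k\<in>J. g k * \<mu> k) = t * V" using V by (simp add: t_def)
  have t0: "t \<ge> 0" unfolding t_def using V \<mu> g
    by (intro divide_nonneg_pos sum_nonneg mult_nonneg_nonneg) (auto intro: less_imp_le)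
  have tangent: "t powr p + p * t powr (p - 1) * (g k - t) \<le> g k powr p" if k: "k \<in> J" for k
  proof (cases "t = 0")
    case False
    then have t: "t > 0" using t0 by simp
    have tp: "t powr p = t powr (p - 1) * t" using t
      by (metis add.commute diff_add_cancel powr_add powr_one t0)
    show ?thesis
    proof (cases "g k = 0")
      case True
      have "t powr (p - 1) * t \<le> p * (t powr (p - 1) * t)"
        using p t by simp
      then show ?thesis using True p by (simp add: tp algebra_simps)
    next
      case False
      then have gk: "g k > 0" using g[OF k] by simp
      \<comment> \<open>Young's inequality for the two \<open>p\<close>-th powers is, after
        multiplication by \<open>p\<close>, a rearrangement of the tangent inequality.\<close>
      have "(g k powr p) powr (1/p) * (t powr p) powr (1 - 1/p) \<le> (1/p) * g k powr p + (1 - 1/p) * t powr p"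
        using p gk t by (intro Youngs_inequality_0) auto
      moreover have "p * (1 - 1/p) = p - 1" using p by (simp add: field_simps)
      ultimately have "g k * t powr (p - 1) \<le> (1/p) * g k powr p + (1 - 1/p) * t powr p"
        using p gk t by (simp add: powr_powr)
      then have "p * (g k * t powr (p - 1)) \<le> p * ((1/p) * g k powr p + (1 - 1/p) * t powr p)"
        using p by (intro mult_left_mono) auto
      also have "\<dots> = g k powr p + (p - 1) * t powr p"
        using p by (simp add: field_simps)
      finally show ?thesis by (simp add: tp algebra_simps)
    qed
  qed (use p in auto)
  have "(\<Sum>k\<in>J. (t powr p + p * t powr (p - 1) * (g k - t)) * \<mu> k)
      = t powr p * V + p * t powr (p - 1) * ((\<Sum>k\<in>J. g k * \<mu> k) - t * V)"
  proof -
    define c where "c = p * t powr (p - 1)"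
    have "(\<Sum>k\<in>J. (t powr p + c * (g k - t)) * \<mu> k)
        = (\<Sum>k\<in>J. t powr p * \<mu> k + (c * (g k * \<mu> k) - c * t * \<mu> k))"
      by (intro sum.cong) (simp_all add: algebra_simps)
    also have "\<dots> = t powr p * V + (c * (\<Sum>k\<in>J. g k * \<mu> k) - c * t * V)"
      unfolding V_def sum.distrib sum_subtractf sum_distrib_left ..
    finally show ?thesis by (simp add: c_def right_diff_distrib mult.assoc)
  qed
  then have "t powr p * V = (\<Sum>k\<in>J. (t powr p + p * t powr (p - 1) * (g k - t)) * \<mu> k)"
    by (simp add: gt)
  also have "\<dots> \<le> (\<Sum>k\<in>J. g k powr p * \<mu> k)"
    using tangent \<mu> by (intro sum_mono mult_right_mono) (auto intro: less_imp_le)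
  finally have *: "t powr p * V \<le> (\<Sum>k\<in>J. g k powr p * \<mu> k)" .
  have "(\<Sum>k\<in>J. g k * \<mu> k) powr p = V powr (p - 1) * (t powr p * V)"
    using V t0 by (simp add: gt powr_mult powr_diff)
  also have "\<dots> \<le> V powr (p - 1) * (\<Sum>k\<in>J. g k powr p * \<mu> k)"
    using * by (intro mult_left_mono) auto
  finally show ?thesis by (simp add: V_def)
qed

text \<open>A Young-type inequality whose coefficient 1/2 on \<open>b powr p\<close> lets that term
  be absorbed on the left of a later estimate. If \<open>2 * c * a\<close> is at most
  \<open>b\<close>, the second summand suffices; otherwise \<open>b\<close> is bounded by a multiple
  of \<open>a\<close> and the first does.\<close>

lemma mult_powr_le_absorb:
  fixes a b p c :: real
  assumes "1 < p" "0 \<le> a" "0 \<le> b" "0 < c"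
  shows "c * (a * b powr (p - 1)) \<le> c * (2 * c) powr (p - 1) * a powr p + b powr p / 2"
proof (cases "2 * c * a \<le> b")
  case True
  have "2 * (c * (a * b powr (p - 1))) \<le> b * b powr (p - 1)"
    using mult_right_mono[OF True, of "b powr (p - 1)"] by (simp add: mult_ac)
  also have "\<dots> = b powr p"
    using assms by (cases "b = 0") (auto simp: powr_diff)
  finally have "c * (a * b powr (p - 1)) \<le> b powr p / 2" by simp
  moreover have "0 \<le> c * (2 * c) powr (p - 1) * a powr p" using assms by simp
  ultimately show ?thesis by linarith
next
  case False
  have "a * b powr (p - 1) \<le> a * (2 * c * a) powr (p - 1)"
    using False assms by (intro mult_left_mono powr_mono2) auto
  also have "\<dots> = (2 * c) powr (p - 1) * (a * a powr (p - 1))"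
    using assms by (simp add: powr_mult)
  also have "a * a powr (p - 1) = a powr p"
    using assms by (cases "a = 0") (auto simp: powr_diff)
  finally have "c * (a * b powr (p - 1)) \<le> c * ((2 * c) powr (p - 1) * a powr p)"
    using assms by (intro mult_left_mono) auto
  then show ?thesis by (smt (verit) powr_ge_zero mult.assoc zero_le_divide_iff)
qed

section \<open>The maximal function of a weighted line\<close>

text \<open>
  Applied to \<open>h = (f - t) \<cdot> \<mu>\<close>, this is the weak-type estimate for the closed level set
  \<open>{M \<ge> t}\<close>; the lemma \<open>left_max_sum_powr_le\<close> integrates it against \<open>t powr (p - 2)\<close>.
\<close>

lemma rising_sun:
  fixes h :: "int \<Rightarrow> real"
  assumes "A \<le> B"
  shows "0 \<le> (\<Sum>k\<in>{k\<in>{A..B}. \<exists>a\<in>{A..k}. 0 \<le> (\<Sum>j\<in>{a..k}. h j)}. h k)"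
proof -
  define E where "E k \<longleftrightarrow> (\<exists>a\<in>{A..k}. 0 \<le> (\<Sum>j\<in>{a..k}. h j))" for k
  define T where "T m = (\<Sum>k\<in>{k\<in>{A..m}. E k}. h k)" for m
  \<comment> \<open>The running total dominates every sum over an interval ending at \<open>m\<close>.\<close>
  have "0 \<le> T B \<and> (\<forall>a\<in>{A..B}. (\<Sum>j\<in>{a..B}. h j) \<le> T B)"
    using assms
  proof (induction B rule: int_ge_induct)
    case base
    have "{k\<in>{A..A}. E k} = (if 0 \<le> h A then {A} else {})"
      by (auto simp: E_def)
    then show ?case by (auto simp: T_def)
  next
    case (step m)
    have split: "(\<Sum>j\<in>{a..m+1}. h j) = (\<Sum>j\<in>{a..m}. h j) + h (m+1)" if "a \<le> m + 1" for a
    proof -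
      have "{a..m+1} = insert (m+1) {a..m}" using that by auto
      then show ?thesis by simp
    qed
    show ?case
    \<comment> \<open>If \<open>E (m + 1)\<close> holds, \<open>T\<close> gains
      \<open>h (m + 1)\<close> just as every sum ending there does, and a witness of
      \<open>E\<close> keeps it nonnegative. Otherwise all these sums are negative while
      \<open>T\<close> stays put.\<close>
    proof (cases "E (m + 1)")
      case True
      have ins: "{k\<in>{A..m+1}. E k} = insert (m+1) {k\<in>{A..m}. E k}"
        using True step.hyps by auto
      have "m + 1 \<notin> {k\<in>{A..m}. E k}" by simp
      moreover have "finite {k\<in>{A..m}. E k}" by (rule finite_subset[of _ "{A..m}"]) auto
      ultimately have T: "T (m+1) = T m + h (m+1)"
        unfolding T_def ins by (subst sum.insert) (auto simp only: add.commute)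
      have le: "(\<Sum>j\<in>{a..m+1}. h j) \<le> T (m+1)" if "a \<in> {A..m+1}" for a
        using that step.IH split[of a] T by (cases "a = m + 1") auto
      moreover have "0 \<le> T (m+1)"
        using True le unfolding E_def by (meson order_trans)
      ultimately show ?thesis by blast
    next
      case False
      have "{k\<in>{A..m+1}. E k} = {k\<in>{A..m}. E k}"
        using False by (auto simp: le_less)
      then have T: "T (m+1) = T m" by (simp add: T_def)
      have "(\<Sum>j\<in>{a..m+1}. h j) \<le> T (m+1)" if "a \<in> {A..m+1}" for a
      proof -
        have "\<not> 0 \<le> (\<Sum>j\<in>{a..m+1}. h j)"
          using False that unfolding E_def by blast
        then show ?thesis using step.IH T by linarith
      qed
      then show ?thesis using step.IH T by simp
    qed
  qed
  then show ?thesis by (simp add: T_def E_def)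
qed

definition wavg :: "(int \<Rightarrow> real) \<Rightarrow> (int \<Rightarrow> real) \<Rightarrow> int set \<Rightarrow> real" where
  "wavg \<mu> f J = (\<Sum>k\<in>J. f k * \<mu> k) / (\<Sum>k\<in>J. \<mu> k)"

definition left_max :: "(int \<Rightarrow> real) \<Rightarrow> (int \<Rightarrow> real) \<Rightarrow> int \<Rightarrow> int \<Rightarrow> real" where
  "left_max \<mu> f A m = Max ((\<lambda>a. wavg \<mu> f {a..m}) ` {A..m})"

lemma wavg_nonneg: "(\<And>k. 0 < \<mu> k) \<Longrightarrow> (\<And>k. 0 \<le> f k) \<Longrightarrow> 0 \<le> wavg \<mu> f J"
  by (simp add: wavg_def sum_nonneg less_imp_le)

lemma sum_pos_atLeastAtMost: "(\<And>k. 0 < \<mu> k) \<Longrightarrow> a \<le> b \<Longrightarrow> 0 < (\<Sum>k\<in>{a..b::int}. \<mu> k :: real)"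
  by (intro sum_pos) auto

lemma wavg_le_left_max: "a \<in> {A..m} \<Longrightarrow> wavg \<mu> f {a..m} \<le> left_max \<mu> f A m"
  unfolding left_max_def by (intro Max_ge) auto

lemma left_max_nonneg:
  "(\<And>k. 0 < \<mu> k) \<Longrightarrow> (\<And>k. 0 \<le> f k) \<Longrightarrow> A \<le> m \<Longrightarrow> 0 \<le> left_max \<mu> f A m"
  using wavg_le_left_max[of m A m \<mu> f] wavg_nonneg[of \<mu> f "{m..m}"] by (force intro: order_trans)

text \<open>Clearing the positive denominator turns the level set of \<open>left_max\<close> into
  the set of \<open>rising_sun\<close> for \<open>h = (f - t) * \<mu>\<close>.\<close>

lemma left_max_ge_iff:
  assumes "\<And>k. 0 < \<mu> k" "A \<le> m"
  shows "t \<le> left_max \<mu> f A m \<longleftrightarrow> (\<exists>a\<in>{A..m}. 0 \<le> (\<Sum>j\<in>{a..m}. (f j - t) * \<mu> j))"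
proof -
  have "t \<le> wavg \<mu> f {a..m} \<longleftrightarrow> 0 \<le> (\<Sum>j\<in>{a..m}. (f j - t) * \<mu> j)" if "a \<in> {A..m}" for a
    using sum_pos_atLeastAtMost[of \<mu> a m] that assms
    by (simp add: wavg_def pos_le_divide_eq left_diff_distrib sum_subtractf sum_distrib_left)
  then show ?thesis
    unfolding left_max_def using assms by (subst Max_ge_iff) auto
qed

lemma left_max_sum_powr_le:
  assumes p: "1 < p" and \<mu>: "\<And>k. 0 < \<mu> k" and f: "\<And>k. 0 \<le> f k" and AB: "A \<le> B"
  shows "(\<Sum>m\<in>{A..B}. left_max \<mu> f A m powr p * \<mu> m)
    \<le> p / (p - 1) * (\<Sum>m\<in>{A..B}. f m * left_max \<mu> f A m powr (p - 1) * \<mu> m)"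
proof -
  define M where "M = left_max \<mu> f A"
  define R where "R = Max (M ` {A..B})"
  have M0: "0 \<le> M k" if "k \<in> {A..B}" for k
    using left_max_nonneg[OF \<mu> f, of A k] that by (simp add: M_def)
  have MR: "M k \<le> R" if "k \<in> {A..B}" for k
    unfolding R_def using that by (intro Max_ge) auto
  \<comment> \<open>The restriction to \<open>t \<le> M k\<close> is built into the integrand, so
    that all \<open>k\<close> share the domain \<open>{0..R}\<close> and the finite sum can be
    exchanged with the integral.\<close>
  define F where "F k t = (if t \<in> {0..M k} then (f k * t powr (p - 2) - t powr (p - 1)) * \<mu> k else 0)" for k t
  have int: "(F k has_integral (f k * (M k powr (p - 1) / (p - 1)) - M k powr p / p) * \<mu> k) {0..R}"
    if k: "k \<in> {A..B}" for k
  proof -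
    \<comment> \<open>The exponent \<open>p - 2\<close> may be negative but exceeds -1, so the
      singularity at 0 is integrable.\<close>
    have "((\<lambda>t. t powr (p - 2)) has_integral (M k powr (p - 2 + 1) / (p - 2 + 1))) {0..M k}"
      using p M0[OF k] by (intro has_integral_powr_from_0) auto
    moreover have "((\<lambda>t. t powr (p - 1)) has_integral (M k powr (p - 1 + 1) / (p - 1 + 1))) {0..M k}"
      using p M0[OF k] by (intro has_integral_powr_from_0) auto
    ultimately have "((\<lambda>t. (f k * t powr (p - 2) - t powr (p - 1)) * \<mu> k) has_integral
        (f k * (M k powr (p - 2 + 1) / (p - 2 + 1)) - M k powr (p - 1 + 1) / (p - 1 + 1)) * \<mu> k) {0..M k}"
      by (intro has_integral_mult_left has_integral_diff has_integral_mult_right)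
    moreover have "p - 2 + 1 = p - 1" by simp
    ultimately show ?thesis
      unfolding F_def using MR[OF k] by (subst has_integral_restrict) auto
  qed
  have "((\<lambda>t. \<Sum>k\<in>{A..B}. F k t) has_integral
      (\<Sum>k\<in>{A..B}. (f k * (M k powr (p - 1) / (p - 1)) - M k powr p / p) * \<mu> k)) {0..R}"
    using int by (intro has_integral_sum) auto
  moreover have "0 \<le> (\<Sum>k\<in>{A..B}. F k t)" if t: "t \<in> {0..R}" for t
  proof -
    have "(\<Sum>k\<in>{A..B}. F k t) = (\<Sum>k\<in>{k\<in>{A..B}. t \<le> M k}. (f k * t powr (p - 2) - t powr (p - 1)) * \<mu> k)"
      using t by (subst sum.inter_filter) (auto simp: F_def intro!: sum.cong)
    also have "\<dots> = t powr (p - 2) * (\<Sum>k\<in>{k\<in>{A..B}. t \<le> M k}. (f k - t) * \<mu> k)"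
    proof -
      \<comment> \<open>At \<open>t = 0\<close> both sides vanish, by the convention
        \<open>0 powr x = 0\<close>.\<close>
      have "t powr (p - 1) = t powr (p - 2) * t"
        using t by (cases "t = 0") (auto simp: powr_diff power2_eq_square)
      then show ?thesis by (simp add: sum_distrib_left algebra_simps)
    qed
    also have "{k\<in>{A..B}. t \<le> M k} = {k\<in>{A..B}. \<exists>a\<in>{A..k}. 0 \<le> (\<Sum>j\<in>{a..k}. (f j - t) * \<mu> j)}"
      unfolding M_def by (intro Collect_cong conj_cong refl left_max_ge_iff \<mu>) simp
    finally show ?thesis using rising_sun[OF AB, of "\<lambda>j. (f j - t) * \<mu> j"] by simp
  qed
  ultimately have "0 \<le> (\<Sum>k\<in>{A..B}. (f k * (M k powr (p - 1) / (p - 1)) - M k powr p / p) * \<mu> k)"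
    by (rule has_integral_nonneg)
  also have "\<dots> = (\<Sum>k\<in>{A..B}. f k * M k powr (p - 1) * \<mu> k) / (p - 1) - (\<Sum>k\<in>{A..B}. M k powr p * \<mu> k) / p"
    by (simp add: sum_subtractf left_diff_distrib sum_divide_distrib)
  finally show ?thesis using p by (simp add: field_simps M_def)
qed

text \<open>The coefficient from \<open>mult_powr_le_absorb\<close> with
  \<open>c = p / (p - 1)\<close>, doubled because half of the left-hand side is absorbed.\<close>

definition max_const :: "real \<Rightarrow> real" where
  "max_const p = 2 * (p / (p - 1) * (2 * (p / (p - 1))) powr (p - 1))"

text \<open>The factor \<open>left_max powr (p - 1)\<close> in the previous bound is split off by
  \<open>mult_powr_le_absorb\<close>. Half of the left-hand sum reappears on the right and may be
  subtracted because the sums are finite.\<close>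

lemma left_max_bound:
  assumes p: "1 < p" and \<mu>: "\<And>k. 0 < \<mu> k" and f: "\<And>k. 0 \<le> f k" and AB: "A \<le> B"
  shows "(\<Sum>m\<in>{A..B}. left_max \<mu> f A m powr p * \<mu> m) \<le> max_const p * (\<Sum>m\<in>{A..B}. f m powr p * \<mu> m)"
proof -
  define M where "M = left_max \<mu> f A"
  define c where "c = p / (p - 1)"
  have c: "c > 0" using p by (simp add: c_def)
  have M0: "0 \<le> M k" if "k \<in> {A..B}" for k
    using left_max_nonneg[OF \<mu> f, of A k] that by (simp add: M_def)
  have "(\<Sum>m\<in>{A..B}. M m powr p * \<mu> m) \<le> c * (\<Sum>m\<in>{A..B}. f m * M m powr (p - 1) * \<mu> m)"
    using left_max_sum_powr_le[OF assms] by (simp add: M_def c_def)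
  also have "\<dots> = (\<Sum>m\<in>{A..B}. c * (f m * M m powr (p - 1)) * \<mu> m)"
    by (simp add: sum_distrib_left mult_ac)
  also have "\<dots> \<le> (\<Sum>m\<in>{A..B}. (c * (2 * c) powr (p - 1) * f m powr p + M m powr p / 2) * \<mu> m)"
    using mult_powr_le_absorb[OF p f M0 c] \<mu>
    by (intro sum_mono mult_right_mono) (auto intro: less_imp_le)
  also have "\<dots> = c * (2 * c) powr (p - 1) * (\<Sum>m\<in>{A..B}. f m powr p * \<mu> m) + (\<Sum>m\<in>{A..B}. M m powr p * \<mu> m) / 2"
    unfolding sum_distrib_left sum_divide_distrib sum.distrib[symmetric]
    by (intro sum.cong) (simp_all add: algebra_simps)
  finally show ?thesis by (simp add: M_def max_const_def c_def)
qed

section \<open>The uncentred maximal function on a finite window\<close>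

definition imax :: "(int \<Rightarrow> real) \<Rightarrow> (int \<Rightarrow> real) \<Rightarrow> int set \<Rightarrow> int \<Rightarrow> real" where
  "imax \<mu> f W m = Max (wavg \<mu> f ` {J \<in> intervals. m \<in> J \<and> J \<subseteq> W})"

lemma finite_intervals_within: "finite W \<Longrightarrow> finite {J \<in> intervals. m \<in> J \<and> J \<subseteq> W}"
  by (rule finite_subset[of _ "Pow W"]) auto

lemma singleton_mem_intervals: "{m} \<in> intervals"
  unfolding intervals_def by (force intro: exI[of _ m])

lemma wavg_le_imax:
  "finite W \<Longrightarrow> J \<in> intervals \<Longrightarrow> m \<in> J \<Longrightarrow> J \<subseteq> W \<Longrightarrow> wavg \<mu> f J \<le> imax \<mu> f W m"
  unfolding imax_def by (intro Max_ge finite_imageI finite_intervals_within) auto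

lemma imax_leI:
  assumes "finite W" "m \<in> W" "\<And>J. J \<in> intervals \<Longrightarrow> m \<in> J \<Longrightarrow> J \<subseteq> W \<Longrightarrow> wavg \<mu> f J \<le> c"
  shows "imax \<mu> f W m \<le> c"
  unfolding imax_def using assms singleton_mem_intervals[of m]
  by (intro Max.boundedI finite_imageI finite_intervals_within) auto

lemma imax_nonneg:
  assumes "\<And>k. 0 < \<mu> k" "\<And>k. 0 \<le> f k" "finite W" "m \<in> W"
  shows "0 \<le> imax \<mu> f W m"
  using wavg_le_imax[OF assms(3) singleton_mem_intervals, of m m \<mu> f] wavg_nonneg[of \<mu> f "{m}"] assms
  by force

lemma sum_uminus_atLeastAtMost: "(\<Sum>k\<in>{a..b}. F (- k)) = (\<Sum>k\<in>{-b..-a}. F k)"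
  for a b :: int and F :: "int \<Rightarrow> real"
  by (rule sum.reindex_bij_witness[of _ uminus uminus]) auto

text \<open>An interval around \<open>m\<close> is cut at \<open>m\<close>; the reflection
  \<open>k \<mapsto> - k\<close> makes its right half end at the base point. Counting
  \<open>m\<close> in both halves only increases the nonnegative sum.\<close>

lemma imax_le_left_max:
  assumes \<mu>: "\<And>k. 0 < \<mu> k" and f: "\<And>k. 0 \<le> f k" and m: "m \<in> {A..B}"
  shows "imax \<mu> f {A..B} m
    \<le> left_max \<mu> f A m + left_max (\<lambda>k. \<mu> (- k)) (\<lambda>k. f (- k)) (- B) (- m)"
    (is "_ \<le> ?L + ?R")
proof (rule imax_leI)
  fix J assume J: "J \<in> intervals" "m \<in> J" "J \<subseteq> {A..B}"
  then obtain a b where ab: "J = {a..b}" "a \<le> m" "m \<le> b" "A \<le> a" "b \<le> B"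
    unfolding intervals_def by auto
  have pos: "0 < (\<Sum>k\<in>{c..d}. \<mu> k)" if "c \<le> d" for c d
    using sum_pos_atLeastAtMost[OF \<mu> that] .
  have L: "wavg \<mu> f {a..m} \<le> ?L" using ab by (intro wavg_le_left_max) auto
  have "wavg (\<lambda>k. \<mu> (- k)) (\<lambda>k. f (- k)) {-b..-m} \<le> ?R" using ab by (intro wavg_le_left_max) auto
  moreover have "wavg (\<lambda>k. \<mu> (- k)) (\<lambda>k. f (- k)) {-b..-m} = wavg \<mu> f {m..b}"
    unfolding wavg_def using sum_uminus_atLeastAtMost[of "\<lambda>k. f k * \<mu> k" "-b" "-m"]
      sum_uminus_atLeastAtMost[of \<mu> "-b" "-m"] by simp
  ultimately have R: "wavg \<mu> f {m..b} \<le> ?R" by simp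
  have L0: "0 \<le> ?L" and R0: "0 \<le> ?R"
    using m by (auto intro!: left_max_nonneg \<mu> f)
  have "(\<Sum>k\<in>{a..b}. f k * \<mu> k) \<le> (\<Sum>k\<in>{a..m}. f k * \<mu> k) + (\<Sum>k\<in>{m..b}. f k * \<mu> k)"
  proof -
    have "{a..b} = {a..m} \<union> {m..b}" using ab by auto
    then show ?thesis
      using sum.union_inter[of "{a..m}" "{m..b}" "\<lambda>k. f k * \<mu> k"]
        sum_nonneg[of "{a..m} \<inter> {m..b}" "\<lambda>k. f k * \<mu> k"] \<mu> f by (simp add: less_imp_le)
  qed
  also have "\<dots> \<le> ?L * (\<Sum>k\<in>{a..m}. \<mu> k) + ?R * (\<Sum>k\<in>{m..b}. \<mu> k)"
    using L R pos[of a m] pos[of m b] ab by (intro add_mono) (auto simp: wavg_def pos_divide_le_eq)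
  also have "\<dots> \<le> ?L * (\<Sum>k\<in>{a..b}. \<mu> k) + ?R * (\<Sum>k\<in>{a..b}. \<mu> k)"
    using L0 R0 ab \<mu> by (intro add_mono mult_left_mono sum_mono2) (auto intro: less_imp_le)
  finally show "wavg \<mu> f J \<le> ?L + ?R"
    using pos[of a b] ab by (simp add: wavg_def pos_divide_le_eq distrib_right)
qed (use m in auto)

text \<open>Splitting the power of the sum costs \<open>2 powr p\<close>, and the two one-sided
  bounds give another factor 2. The constant depends on neither \<mu> nor the window, so the bound
  serves both \<open>w\<close> and its dual weight.\<close>

lemma imax_bound:
  assumes p: "1 < p" and \<mu>: "\<And>k. 0 < \<mu> k" and f: "\<And>k. 0 \<le> f k" and AB: "A \<le> B"
  shows "(\<Sum>m\<in>{A..B}. imax \<mu> f {A..B} m powr p * \<mu> m)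
    \<le> 2 powr (p + 1) * max_const p * (\<Sum>m\<in>{A..B}. f m powr p * \<mu> m)"
proof -
  let ?\<mu> = "\<lambda>k. \<mu> (- k)" and ?f = "\<lambda>k. f (- k)"
  let ?S = "\<Sum>m\<in>{A..B}. f m powr p * \<mu> m"
  have "(\<Sum>m\<in>{A..B}. imax \<mu> f {A..B} m powr p * \<mu> m)
    \<le> (\<Sum>m\<in>{A..B}. (2 powr p * (left_max \<mu> f A m powr p + left_max ?\<mu> ?f (-B) (-m) powr p)) * \<mu> m)"
  proof (intro sum_mono mult_right_mono)
    fix m assume m: "m \<in> {A..B}"
    have "imax \<mu> f {A..B} m powr p \<le> (left_max \<mu> f A m + left_max ?\<mu> ?f (-B) (-m)) powr p"
      using p m imax_le_left_max[OF \<mu> f m] by (intro powr_mono2 imax_nonneg \<mu> f) auto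
    also have "\<dots> \<le> 2 powr p * (left_max \<mu> f A m powr p + left_max ?\<mu> ?f (-B) (-m) powr p)"
      using p m by (intro powr_add_le left_max_nonneg \<mu> f) auto
    finally show "imax \<mu> f {A..B} m powr p \<le> 2 powr p * (left_max \<mu> f A m powr p + left_max ?\<mu> ?f (-B) (-m) powr p)" .
  qed (use \<mu> in \<open>auto intro: less_imp_le\<close>)
  also have "\<dots> = 2 powr p * ((\<Sum>m\<in>{A..B}. left_max \<mu> f A m powr p * \<mu> m)
      + (\<Sum>m\<in>{A..B}. left_max ?\<mu> ?f (-B) (-m) powr p * \<mu> m))"
    by (simp add: distrib_left distrib_right sum.distrib sum_distrib_left mult_ac)
  also have "(\<Sum>m\<in>{A..B}. left_max ?\<mu> ?f (-B) (-m) powr p * \<mu> m)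
      = (\<Sum>m\<in>{-B..-A}. left_max ?\<mu> ?f (-B) m powr p * ?\<mu> m)"
    using sum_uminus_atLeastAtMost[of "\<lambda>m. left_max ?\<mu> ?f (-B) m powr p * ?\<mu> m" A B] by simp
  also have "2 powr p * ((\<Sum>m\<in>{A..B}. left_max \<mu> f A m powr p * \<mu> m) + \<dots>)
      \<le> 2 powr p * (max_const p * ?S + max_const p * (\<Sum>m\<in>{-B..-A}. ?f m powr p * ?\<mu> m))"
    using AB by (intro mult_left_mono add_mono left_max_bound p \<mu> f) auto
  also have "(\<Sum>m\<in>{-B..-A}. ?f m powr p * ?\<mu> m) = ?S"
    using sum_uminus_atLeastAtMost[of "\<lambda>m. f m powr p * \<mu> m" "-B" "-A"] by simp
  finally show ?thesis by (simp add: powr_add mult_ac)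
qed

section \<open>Muckenhoupt weights\<close>

definition dual_weight :: "real \<Rightarrow> (int \<Rightarrow> real) \<Rightarrow> int \<Rightarrow> real" where
  "dual_weight r w k = w k powr (- 1 / (r - 1))"

text \<open>The A_r condition with explicit constant, cleared of denominators: the two averages
  contribute \<open>card J\<close> to the powers 1 and \<open>r - 1\<close>.\<close>

definition muckenhoupt_bound :: "real \<Rightarrow> (int \<Rightarrow> real) \<Rightarrow> real \<Rightarrow> bool" where
  "muckenhoupt_bound r w D \<longleftrightarrow> 0 < D \<and> (\<forall>J\<in>intervals.
     (\<Sum>k\<in>J. w k) * (\<Sum>k\<in>J. dual_weight r w k) powr (r - 1) \<le> D * real (card J) powr r)"

lemma dual_weight_nonneg [simp]: "0 \<le> dual_weight r w k"
  by (simp add: dual_weight_def)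

lemma intervalsD: "J \<in> intervals \<Longrightarrow> finite J \<and> J \<noteq> {} \<and> 0 < card J"
  by (auto simp: intervals_def)

lemma muckenhoupt_quotient_eq:
  assumes "J \<in> intervals" "\<And>k. 0 < w k" "1 < r"
  shows "(1 / real (card J) * (\<Sum>k\<in>J. w k)) *
         (1 / real (card J) * (\<Sum>k\<in>J. w k powr (- 1 / (r - 1)))) powr (r - 1)
       = (\<Sum>k\<in>J. w k) * (\<Sum>k\<in>J. dual_weight r w k) powr (r - 1) / real (card J) powr r"
proof -
  have J: "finite J" "J \<noteq> {}" "0 < real (card J)" using intervalsD[OF assms(1)] by auto
  define S where "S = (\<Sum>k\<in>J. dual_weight r w k)"
  have S: "(\<Sum>k\<in>J. w k powr (- 1 / (r - 1))) = S" unfolding S_def dual_weight_def ..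
  have "0 \<le> S" by (simp add: S_def sum_nonneg)
  moreover have "real (card J) powr r = real (card J) powr (r - 1) * real (card J)"
    using J(3) by (simp add: powr_diff)
  ultimately show ?thesis
    unfolding S S_def[symmetric] using J(3) by (simp add: powr_divide)
qed

lemma muckenhoupt_iff:
  assumes "\<And>k. 0 < w k" "1 < r"
  shows "w \<in> muckenhoupt r \<longleftrightarrow> (\<exists>D. muckenhoupt_bound r w D)"
proof -
  define Q where "Q J = (1 / real (card J) * (\<Sum>k\<in>J. w k)) *
         (1 / real (card J) * (\<Sum>k\<in>J. w k powr (- 1 / (r - 1)))) powr (r - 1)" for J
  have Q: "Q J \<le> D \<longleftrightarrow> (\<Sum>k\<in>J. w k) * (\<Sum>k\<in>J. dual_weight r w k) powr (r - 1) \<le> D * real (card J) powr r"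
    if "J \<in> intervals" for J D
    using muckenhoupt_quotient_eq[OF that assms] intervalsD[OF that]
    by (simp add: Q_def pos_divide_le_eq)
  have "w \<in> muckenhoupt r \<longleftrightarrow> (SUP J\<in>intervals. ennreal (Q J)) < \<infinity>"
    by (simp add: muckenhoupt_def Q_def)
  also have "\<dots> \<longleftrightarrow> (\<exists>D>0. \<forall>J\<in>intervals. Q J \<le> D)"
  proof
    assume fin: "(SUP J\<in>intervals. ennreal (Q J)) < \<infinity>"
    define D where "D = enn2real (SUP J\<in>intervals. ennreal (Q J))"
    \<comment> \<open>Adding 1 makes the constant strictly positive, as
      \<open>muckenhoupt_bound\<close> demands.\<close>
    have "Q J \<le> D + 1" if "J \<in> intervals" for J
    proof -
      have "ennreal (Q J) \<le> (SUP J\<in>intervals. ennreal (Q J))" using that by (rule SUP_upper)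
      also have "\<dots> = ennreal D" using fin by (simp add: D_def)
      finally show ?thesis by (simp add: D_def)
    qed
    moreover have "0 < D + 1" by (simp add: D_def add_nonneg_pos)
    ultimately show "\<exists>D>0. \<forall>J\<in>intervals. Q J \<le> D" by blast
  next
    assume "\<exists>D>0. \<forall>J\<in>intervals. Q J \<le> D"
    then obtain D where "\<forall>J\<in>intervals. Q J \<le> D" by blast
    then have "(SUP J\<in>intervals. ennreal (Q J)) \<le> ennreal D"
      by (intro SUP_least ennreal_leI) auto
    then show "(SUP J\<in>intervals. ennreal (Q J)) < \<infinity>" 
      using le_less_trans by fastforce
  qed
  finally show ?thesis using Q by (auto simp: muckenhoupt_bound_def)
qed

lemma dual_weight_pos: "0 < w k \<Longrightarrow> 0 < dual_weight r w k"
  by (simp add: dual_weight_def)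

text \<open>Because the dual weight \<sigma> satisfies \<open>\<sigma> powr (r - 1) = 1 / w\<close>,
  division by \<sigma> carries the \<open>r\<close>-norm for \<open>w\<close> isometrically to the
  one for \<sigma>.\<close>

lemma dual_weight_powr:
  assumes "0 < w k" "1 < r" "0 \<le> a"
  shows "(a / dual_weight r w k) powr r * dual_weight r w k = a powr r * w k"
proof -
  have "dual_weight r w k powr r = dual_weight r w k powr (r - 1) * dual_weight r w k"
    using dual_weight_pos[of w k r] assms by (simp add: powr_diff)
  moreover have "dual_weight r w k powr (r - 1) = 1 / w k"
  proof -
    have "- 1 / (r - 1) * (r - 1) = - 1" using assms by simp
    then show ?thesis
      unfolding dual_weight_def powr_powr using assms by (simp only: powr_minus_divide) simp
  qed
  ultimately show ?thesis
    using assms dual_weight_pos[of w k r] by (simp add: powr_divide)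
qed

section \<open>Averages and maximal functions under the A_p condition\<close>

text \<open>Jensen's inequality for \<open>f / \<sigma>\<close> with respect to the dual weight
  \<sigma>, followed by A_p. It yields both doubling and the control of long averages.\<close>

lemma muckenhoupt_average_le:
  assumes p: "1 < p" and w: "\<And>k. 0 < w k" and D: "muckenhoupt_bound p w D"
    and J: "J \<in> intervals" and f: "\<And>k. 0 \<le> f k"
  shows "(\<Sum>k\<in>J. f k) powr p * (\<Sum>k\<in>J. w k) \<le> D * real (card J) powr p * (\<Sum>k\<in>J. f k powr p * w k)"
proof -
  let ?s = "dual_weight p w"
  have s: "0 < ?s k" for k using dual_weight_pos[OF w] .
  have "(\<Sum>k\<in>J. f k) powr p = (\<Sum>k\<in>J. (f k / ?s k) * ?s k) powr p"
    using s by (simp add: less_imp_neq[symmetric] cong: sum.cong)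
  also have "\<dots> \<le> (\<Sum>k\<in>J. ?s k) powr (p - 1) * (\<Sum>k\<in>J. (f k / ?s k) powr p * ?s k)"
    using intervalsD[OF J] f s p by (intro powr_sum_le_sum_powr) auto
  also have "\<dots> = (\<Sum>k\<in>J. ?s k) powr (p - 1) * (\<Sum>k\<in>J. f k powr p * w k)"
    using dual_weight_powr[OF w p f] by simp
  finally have "(\<Sum>k\<in>J. f k) powr p * (\<Sum>k\<in>J. w k)
      \<le> ((\<Sum>k\<in>J. ?s k) powr (p - 1) * (\<Sum>k\<in>J. f k powr p * w k)) * (\<Sum>k\<in>J. w k)"
    using w by (intro mult_right_mono sum_nonneg) (auto intro: less_imp_le)
  also have "\<dots> = ((\<Sum>k\<in>J. w k) * (\<Sum>k\<in>J. ?s k) powr (p - 1)) * (\<Sum>k\<in>J. f k powr p * w k)"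
    by simp
  also have "\<dots> \<le> D * real (card J) powr p * (\<Sum>k\<in>J. f k powr p * w k)"
    using D J w unfolding muckenhoupt_bound_def
    by (intro mult_right_mono sum_nonneg mult_nonneg_nonneg) (auto intro: less_imp_le)
  finally show ?thesis .
qed

text \<open>
  Lerner's pointwise estimate: for \<open>y \<in> J\<close>, the \<open>\<sigma>\<close>-average of \<open>f / \<sigma>\<close> over \<open>J\<close> is at most
  \<open>g y\<close>. Averaging this over \<open>y \<in> J\<close> with respect to \<open>w\<close> and invoking \<open>A\<^sub>p\<close> leaves a
  \<open>w\<close>-average of \<open>g\<^sup>p\<^sup>-\<^sup>1 / w\<close>.
\<close>

lemma muckenhoupt_imax_powr_le:
  fixes p D :: real and w f :: "int \<Rightarrow> real" and W :: "int set"
  defines "g \<equiv> imax (dual_weight p w) (\<lambda>k. f k / dual_weight p w k) W"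
  assumes p: "1 < p" and w: "\<And>k. 0 < w k" and D: "muckenhoupt_bound p w D"
    and f: "\<And>k. 0 \<le> f k" and W: "finite W" "m \<in> W"
  shows "imax (\<lambda>_. 1) f W m \<le> (D * imax w (\<lambda>k. g k powr (p - 1) / w k) W m) powr (1 / (p - 1))"
proof (rule imax_leI[OF W])
  fix J assume J: "J \<in> intervals" "m \<in> J" "J \<subseteq> W"
  let ?s = "dual_weight p w"
  let ?n = "real (card J)"
  define H where "H = imax w (\<lambda>k. g k powr (p - 1) / w k) W m"
  define F where "F = (\<Sum>k\<in>J. f k)"
  have s: "0 < ?s k" for k using dual_weight_pos[OF w] .
  have fJ: "finite J" "J \<noteq> {}" "0 < ?n" using intervalsD[OF J(1)] by auto
  have sJ: "0 < (\<Sum>k\<in>J. ?s k)" and wJ: "0 < (\<Sum>k\<in>J. w k)"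
    using fJ s w by (auto intro!: sum_pos)
  have F0: "0 \<le> F" using f by (simp add: F_def sum_nonneg)
  have Fg: "F powr (p - 1) \<le> (\<Sum>k\<in>J. ?s k) powr (p - 1) * g y powr (p - 1)" if y: "y \<in> J" for y
  proof -
    have "wavg ?s (\<lambda>k. f k / ?s k) J \<le> g y"
      unfolding g_def using J y W by (intro wavg_le_imax) auto
    moreover have "wavg ?s (\<lambda>k. f k / ?s k) J = F / (\<Sum>k\<in>J. ?s k)"
      using s by (simp add: wavg_def F_def less_imp_neq[symmetric] cong: sum.cong)
    ultimately have *: "F \<le> (\<Sum>k\<in>J. ?s k) * g y" using sJ by (simp add: pos_divide_le_eq mult.commute)
    have "0 \<le> g y"
      unfolding g_def using s f W J y by (intro imax_nonneg) auto
    then show ?thesis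
      using powr_mono2[OF _ F0 *, of "p - 1"] p sJ by (simp add: powr_mult)
  qed
  have "?n * F powr (p - 1) = (\<Sum>y\<in>J. F powr (p - 1))" by simp
  also have "\<dots> \<le> (\<Sum>y\<in>J. (\<Sum>k\<in>J. ?s k) powr (p - 1) * g y powr (p - 1))"
    using Fg by (intro sum_mono)
  also have "\<dots> = (\<Sum>k\<in>J. ?s k) powr (p - 1) * (\<Sum>y\<in>J. g y powr (p - 1))"
    by (simp add: sum_distrib_left)
  also have "(\<Sum>y\<in>J. g y powr (p - 1)) = wavg w (\<lambda>k. g k powr (p - 1) / w k) J * (\<Sum>k\<in>J. w k)"
    using wJ w by (simp add: wavg_def less_imp_neq[symmetric] cong: sum.cong)
  also have "(\<Sum>k\<in>J. ?s k) powr (p - 1) * \<dots> \<le> (\<Sum>k\<in>J. ?s k) powr (p - 1) * (H * (\<Sum>k\<in>J. w k))"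
    unfolding H_def using J W wJ by (intro mult_left_mono mult_right_mono wavg_le_imax) auto
  also have "\<dots> = ((\<Sum>k\<in>J. w k) * (\<Sum>k\<in>J. ?s k) powr (p - 1)) * H" by simp
  also have "\<dots> \<le> (D * ?n powr p) * H"
  proof (rule mult_right_mono)
    show "(\<Sum>k\<in>J. w k) * (\<Sum>k\<in>J. ?s k) powr (p - 1) \<le> D * ?n powr p"
      using D J unfolding muckenhoupt_bound_def by blast
    show "0 \<le> H" unfolding H_def using w W by (intro imax_nonneg) (auto intro: divide_nonneg_pos)
  qed
  \<comment> \<open>One factor \<open>?n\<close> cancels the number of points \<open>y\<close>; the
    remaining \<open>?n powr (p - 1)\<close> turns \<open>F\<close> into an average.\<close>
  also have "\<dots> = ?n * (D * H * ?n powr (p - 1))" using fJ by (simp add: powr_diff)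
  finally have "F powr (p - 1) \<le> D * H * ?n powr (p - 1)" using fJ by simp
  then have "(F / ?n) powr (p - 1) \<le> D * H" using fJ F0 by (simp add: powr_divide pos_divide_le_eq)
  then have "((F / ?n) powr (p - 1)) powr (1 / (p - 1)) \<le> (D * H) powr (1 / (p - 1))"
    using p by (intro powr_mono2) auto
  then show "wavg (\<lambda>_. 1) f J \<le> (D * imax w (\<lambda>k. g k powr (p - 1) / w k) W m) powr (1 / (p - 1))"
    using p F0 fJ by (simp add: powr_powr wavg_def F_def H_def)
qed

text \<open>Lerner's estimate raised to the power \<open>p\<close> involves the conjugate exponent
  \<open>r = p / (p - 1)\<close>. Then \<open>imax_bound\<close> is used twice: with weight
  \<open>w\<close> and exponent \<open>r\<close>, and with the dual weight and exponent
  \<open>p\<close>.\<close>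

lemma muckenhoupt_imax_bound:
  assumes p: "1 < p" and w: "\<And>k. 0 < w k" and D: "muckenhoupt_bound p w D"
  shows "\<exists>K>0. \<forall>f A B. (\<forall>k. 0 \<le> f k) \<longrightarrow> A \<le> B \<longrightarrow>
    (\<Sum>m\<in>{A..B}. imax (\<lambda>_. 1) f {A..B} m powr p * w m) \<le> K * (\<Sum>m\<in>{A..B}. f m powr p * w m)"
proof -
  define r where "r = p / (p - 1)"
  define C where "C = (\<lambda>r::real. 2 powr (r + 1) * max_const r)"
  define K where "K = D powr r * (C r * C p)"
  have r: "1 < r" using p by (simp add: r_def)
  have C: "0 < C t" if "1 < t" for t using that by (simp add: C_def max_const_def)
  have D0: "0 < D" using D by (simp add: muckenhoupt_bound_def)
  have "0 < K" using C[OF p] C[OF r] D0 by (simp add: K_def)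
  moreover have "(\<Sum>m\<in>{A..B}. imax (\<lambda>_. 1) f {A..B} m powr p * w m) \<le> K * (\<Sum>m\<in>{A..B}. f m powr p * w m)"
    if f: "\<forall>k. 0 \<le> f k" and AB: "A \<le> B" for f A B
  proof -
    let ?s = "dual_weight p w" and ?W = "{A..B}"
    define g where "g = imax ?s (\<lambda>k. f k / ?s k) ?W"
    define h where "h k = g k powr (p - 1) / w k" for k
    define H where "H = imax w h ?W"
    have s: "0 < ?s k" for k using dual_weight_pos[OF w] .
    have h0: "0 \<le> h k" for k using w by (simp add: h_def less_imp_le)
    have H0: "0 \<le> H m" if "m \<in> ?W" for m
      unfolding H_def using that w h0 by (intro imax_nonneg) auto
    have g0: "0 \<le> g m" if "m \<in> ?W" for m
      unfolding g_def using that s f by (intro imax_nonneg) auto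
    have "imax (\<lambda>_. 1) f ?W m powr p \<le> D powr r * H m powr r" if m: "m \<in> ?W" for m
    proof -
      have "imax (\<lambda>_. 1) f ?W m \<le> (D * H m) powr (1 / (p - 1))"
        using muckenhoupt_imax_powr_le[OF p w D, of f ?W m] f m
        by (simp add: H_def g_def h_def[abs_def])
      then have "imax (\<lambda>_. 1) f ?W m powr p \<le> ((D * H m) powr (1 / (p - 1))) powr p"
        using p f m by (intro powr_mono2 imax_nonneg) auto
      then show ?thesis using D0 H0[OF m] by (simp add: powr_powr powr_mult r_def)
    qed
    then have "(\<Sum>m\<in>?W. imax (\<lambda>_. 1) f ?W m powr p * w m) \<le> (\<Sum>m\<in>?W. D powr r * H m powr r * w m)"
      using w by (intro sum_mono mult_right_mono) (auto intro: less_imp_le)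
    also have "\<dots> = D powr r * (\<Sum>m\<in>?W. H m powr r * w m)" by (simp add: sum_distrib_left mult_ac)
    also have "\<dots> \<le> D powr r * (C r * (\<Sum>m\<in>?W. h m powr r * w m))"
      unfolding H_def C_def using imax_bound[OF r w h0 AB] by (intro mult_left_mono) auto
    \<comment> \<open>Here \<open>(p - 1) * r = p\<close>, and \<open>w powr (1 - r)\<close> is the
      dual weight since \<open>r - 1 = 1 / (p - 1)\<close>.\<close>
    also have "(\<Sum>m\<in>?W. h m powr r * w m) = (\<Sum>m\<in>?W. g m powr p * ?s m)"
    proof (rule sum.cong)
      fix m assume m: "m \<in> ?W"
      have "r - 1 = 1 / (p - 1)" using p by (simp add: r_def field_simps)
      then have "w m powr r = w m * w m powr (1 / (p - 1))"
        using w[of m] by (metis add.commute diff_add_cancel less_eq_real_def powr_add powr_one)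
      moreover have "?s m = 1 / w m powr (1 / (p - 1))"
        by (simp add: dual_weight_def powr_minus_divide)
      ultimately have "?s m = w m / w m powr r" using w[of m] by simp
      moreover have "h m powr r = g m powr p / w m powr r"
        using g0[OF m] w[of m] p by (simp add: h_def powr_divide powr_powr r_def less_imp_le)
      ultimately show "h m powr r * w m = g m powr p * ?s m" by simp
    qed simp
    also have "D powr r * (C r * \<dots>) \<le> D powr r * (C r * (C p * (\<Sum>m\<in>?W. (f m / ?s m) powr p * ?s m)))"
    proof (intro mult_left_mono)
      show "(\<Sum>m\<in>?W. g m powr p * ?s m) \<le> C p * (\<Sum>m\<in>?W. (f m / ?s m) powr p * ?s m)"
        unfolding g_def C_def using f by (intro imax_bound[OF p s _ AB]) auto
    qed (use C[OF r] in simp_all)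
    also have "(\<Sum>m\<in>?W. (f m / ?s m) powr p * ?s m) = (\<Sum>m\<in>?W. f m powr p * w m)"
      using dual_weight_powr[OF w p] f by simp
    finally show ?thesis by (simp add: K_def mult_ac)
  qed
  ultimately show ?thesis by blast
qed

lemma symm_interval_eq: "symm_interval m N = {m - int N..m + int N}"
  by (auto simp: symm_interval_def)

lemma card_symm_interval: "card (symm_interval m N) = 2 * N + 1"
  by (simp add: symm_interval_eq)

lemma symm_interval_mem_intervals: "symm_interval m N \<in> intervals"
  by (auto simp: symm_interval_eq intervals_def)

section \<open>Weighted Morrey norms\<close>

lemma powr_inverse_le_iff:
  fixes t B p :: real
  assumes "0 < p" "0 \<le> t" "0 \<le> B"
  shows "t powr (1 / p) \<le> B \<longleftrightarrow> t \<le> B powr p"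
proof
  assume "t powr (1 / p) \<le> B"
  then have "(t powr (1 / p)) powr p \<le> B powr p" using assms by (intro powr_mono2) auto
  then show "t \<le> B powr p" using assms by (simp add: powr_powr)
next
  assume "t \<le> B powr p"
  then have "t powr (1 / p) \<le> (B powr p) powr (1 / p)" using assms by (intro powr_mono2) auto
  then show "t powr (1 / p) \<le> B" using assms by (simp add: powr_powr)
qed

text \<open>Taking \<open>p\<close>-th powers and moving the positive mass of each window to the
  right replaces the norm by local sum estimates, the form in which it is both used and
  verified.\<close>

lemma morrey_norm_le_iff:
  assumes p: "0 < p" and q: "0 < q" and w: "\<And>k. 0 < w k" and B: "0 \<le> B"
  shows "morrey_norm p q w x \<le> ennreal B \<longleftrightarrow>
    (\<forall>m N. (\<Sum>k\<in>symm_interval m N. \<bar>x k\<bar> powr p * w k)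
      \<le> B powr p * (\<Sum>k\<in>symm_interval m N. w k) powr (1 - p / q))"
proof -
  have "(\<Sum>k\<in>S. w k) powr (1 / q - 1 / p) * (\<Sum>k\<in>S. \<bar>x k\<bar> powr p * w k) powr (1 / p) \<le> B
      \<longleftrightarrow> (\<Sum>k\<in>S. \<bar>x k\<bar> powr p * w k) \<le> B powr p * (\<Sum>k\<in>S. w k) powr (1 - p / q)"
    if S: "S \<in> intervals" for S
  proof -
    define V X where "V = (\<Sum>k\<in>S. w k)" and "X = (\<Sum>k\<in>S. \<bar>x k\<bar> powr p * w k)"
    have V: "0 < V" unfolding V_def using intervalsD[OF S] w by (intro sum_pos) auto
    have X: "0 \<le> X" unfolding X_def using w by (intro sum_nonneg) (simp add: less_imp_le)
    have e: "1 / q - 1 / p = - (1 - p / q) * (1 / p)" using p q by (simp add: field_simps)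
    have "V powr (1 / q - 1 / p) * X powr (1 / p) = (X / V powr (1 - p / q)) powr (1 / p)"
      unfolding e using V X by (simp only: powr_powr[symmetric] powr_minus_divide)
        (simp add: powr_divide powr_mult)
    then show ?thesis
      unfolding V_def[symmetric] X_def[symmetric]
      using V X p B by (simp add: powr_inverse_le_iff pos_divide_le_eq)
  qed
  then show ?thesis
    using B symm_interval_mem_intervals by (auto simp: morrey_norm_def SUP_le_iff ennreal_le_iff)
qed

section \<open>Sufficiency of the A_p condition\<close>

text \<open>This is \<open>muckenhoupt_average_le\<close> tested on the indicator of
  \<open>S\<close>; the ratio of cardinalities contributes \<open>2 powr p\<close>.\<close>

lemma muckenhoupt_doubling:
  assumes p: "1 < p" and w: "\<And>k. 0 < w k" and D: "muckenhoupt_bound p w D"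
    and SW: "S \<in> intervals" "W \<in> intervals" "S \<subseteq> W" "card W \<le> 2 * card S"
  shows "(\<Sum>k\<in>W. w k) \<le> D * 2 powr p * (\<Sum>k\<in>S. w k)"
proof -
  have fin: "finite W" "0 < real (card S)" using intervalsD SW by auto
  have D0: "0 < D" using D by (simp add: muckenhoupt_bound_def)
  have "(\<Sum>k\<in>W. indicator S k) powr p * (\<Sum>k\<in>W. w k)
      \<le> D * real (card W) powr p * (\<Sum>k\<in>W. indicator S k powr p * w k)"
    using SW by (intro muckenhoupt_average_le p w D) auto
  moreover have "(\<Sum>k\<in>W. indicator S k) = real (card S)"
  proof -
    have "(\<Sum>k\<in>W. indicator S k) = (\<Sum>k\<in>S. 1::real)"
      using fin SW by (intro sum.mono_neutral_cong_right) auto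
    then show ?thesis by simp
  qed
  moreover have "(\<Sum>k\<in>W. indicator S k powr p * w k) = (\<Sum>k\<in>S. w k)"
    using fin SW by (intro sum.mono_neutral_cong_right) auto
  ultimately have "real (card S) powr p * (\<Sum>k\<in>W. w k) \<le> D * real (card W) powr p * (\<Sum>k\<in>S. w k)"
    by simp
  also have "\<dots> \<le> D * (2 * real (card S)) powr p * (\<Sum>k\<in>S. w k)"
    using SW p D0 w by (intro mult_right_mono mult_left_mono powr_mono2 sum_nonneg) (auto intro: less_imp_le)
  also have "\<dots> = real (card S) powr p * (D * 2 powr p * (\<Sum>k\<in>S. w k))"
    by (simp add: powr_mult mult_ac)
  finally show ?thesis using fin by simp
qed

text \<open>The A_p average bound and the Morrey bound on the long interval combine to the mass
  \<open>V\<close> with exponent \<open>- 1 / q\<close>. This negative power only grows when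
  \<open>V\<close> is replaced by the smaller mass \<open>U\<close> of the short interval.\<close>

lemma muckenhoupt_morrey_sum_le:
  assumes p: "1 < p" and q: "p < q" and w: "\<And>k. 0 < w k" and D: "muckenhoupt_bound p w D"
    and B: "0 \<le> B" and norm: "morrey_norm p q w x \<le> ennreal B" and NL: "N \<le> L"
  shows "(\<Sum>k\<in>symm_interval m L. \<bar>x k\<bar>)
    \<le> D powr (1 / p) * real (card (symm_interval m L)) * B * (\<Sum>k\<in>symm_interval m N. w k) powr (- 1 / q)"
proof -
  let ?J = "symm_interval m L" and ?S = "symm_interval m N"
  define V where "V = (\<Sum>k\<in>?J. w k)"
  define U where "U = (\<Sum>k\<in>?S. w k)"
  define F where "F = (\<Sum>k\<in>?J. \<bar>x k\<bar>)"
  define n where "n = real (card ?J)"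
  have D0: "0 < D" using D by (simp add: muckenhoupt_bound_def)
  have fin: "finite ?J" by (simp add: symm_interval_eq)
  have U: "0 < U" unfolding U_def using w by (intro sum_pos) (auto simp: symm_interval_eq)
  have UV: "U \<le> V"
    unfolding U_def V_def using w NL by (intro sum_mono2) (auto simp: symm_interval_eq intro: less_imp_le)
  have V: "0 < V" using U UV by simp
  have F: "0 \<le> F" by (simp add: F_def sum_nonneg)
  have "F powr p * V \<le> D * n powr p * (\<Sum>k\<in>?J. \<bar>x k\<bar> powr p * w k)"
    unfolding F_def V_def n_def
    by (intro muckenhoupt_average_le p w D symm_interval_mem_intervals) auto
  also have "\<dots> \<le> D * n powr p * (B powr p * V powr (1 - p / q))"
    using norm p q w B D0 unfolding V_def
    by (intro mult_left_mono) (auto simp: morrey_norm_le_iff)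
  also have "\<dots> = D * n powr p * (B powr p * V powr (- (p / q))) * V"
    using V by (simp add: powr_diff powr_minus_divide)
  finally have "F powr p \<le> D * n powr p * (B powr p * V powr (- (p / q)))" using V by simp
  also have "\<dots> \<le> D * n powr p * (B powr p * U powr (- (p / q)))"
    using p q U UV D0 by (intro mult_left_mono powr_mono2') auto
  also have "\<dots> = (D powr (1 / p) * n * B * U powr (- 1 / q)) powr p"
    using p D0 B by (simp add: powr_mult powr_powr n_def)
  finally have "F \<le> D powr (1 / p) * n * B * U powr (- 1 / q)"
    using powr_less_mono2[of p "D powr (1 / p) * n * B * U powr (- 1 / q)" F] p B
    by (force simp: n_def)
  then show ?thesis by (simp add: F_def U_def n_def)
qed

lemma maximal_op_le:
  assumes p: "1 < p" and q: "p < q" and w: "\<And>k. 0 < w k" and D: "muckenhoupt_bound p w D"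
    and B: "0 \<le> B" and norm: "morrey_norm p q w x \<le> ennreal B" and m: "m \<in> symm_interval a N"
  shows "maximal_op x m \<le> ennreal (imax (\<lambda>_. 1) (\<lambda>k. \<bar>x k\<bar>) (symm_interval a (2 * N)) m
    + 2 * D powr (1 / p) * B * (\<Sum>k\<in>symm_interval a N. w k) powr (- 1 / q))"
  unfolding maximal_op_def
proof (intro SUP_least ennreal_leI)
  fix n
  let ?J = "symm_interval m n" and ?W = "symm_interval a (2 * N)"
  define I where "I = imax (\<lambda>_. 1) (\<lambda>k. \<bar>x k\<bar>) ?W m"
  define E where "E = D powr (1 / p) * B * (\<Sum>k\<in>symm_interval a N. w k) powr (- 1 / q)"
  have E: "0 \<le> E" using B by (simp add: E_def)
  have I: "0 \<le> I"
    unfolding I_def using m by (intro imax_nonneg) (auto simp: symm_interval_eq)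
  have "1 / real (card ?J) * (\<Sum>k\<in>?J. \<bar>x k\<bar>) \<le> I + 2 * E"
  proof (cases "n \<le> N")
    case True
    have "wavg (\<lambda>_. 1) (\<lambda>k. \<bar>x k\<bar>) ?J \<le> I"
      unfolding I_def using True m
      by (intro wavg_le_imax symm_interval_mem_intervals) (auto simp: symm_interval_eq)
    then show ?thesis using E by (simp add: wavg_def)
  next
    case False
    \<comment> \<open>Since \<open>m\<close> is within \<open>N < n\<close> of \<open>a\<close>,
      recentring at \<open>a\<close> with radius \<open>2 * n\<close> covers \<open>?J\<close>. The
      bound \<open>4 * n + 1 \<le> 2 * (2 * n + 1)\<close> on cardinalities gives the factor
      2.\<close>
    let ?L = "symm_interval a (2 * n)"
    have "(\<Sum>k\<in>?J. \<bar>x k\<bar>) \<le> (\<Sum>k\<in>?L. \<bar>x k\<bar>)"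
      using False m by (intro sum_mono2) (auto simp: symm_interval_eq)
    also have "\<dots> \<le> real (card ?L) * E"
      using muckenhoupt_morrey_sum_le[OF p q w D B norm, of N "2 * n" a] False
      by (simp add: E_def mult_ac)
    also have "\<dots> \<le> (2 * real (card ?J)) * E"
      using E by (intro mult_right_mono) (auto simp: card_symm_interval)
    finally have "1 / real (card ?J) * (\<Sum>k\<in>?J. \<bar>x k\<bar>) \<le> 2 * E"
      by (simp add: card_symm_interval pos_divide_le_eq mult_ac)
    then show ?thesis using I by simp
  qed
  then show "1 / real (card ?J) * (\<Sum>k\<in>?J. \<bar>x k\<bar>)
      \<le> imax (\<lambda>_. 1) (\<lambda>k. \<bar>x k\<bar>) ?W m
        + 2 * D powr (1 / p) * B * (\<Sum>k\<in>symm_interval a N. w k) powr (- 1 / q)"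
    by (simp add: I_def E_def mult_ac)
qed

lemma morrey_spaceE:
  assumes "x \<in> morrey_space p q w"
  obtains B where "0 \<le> B" "morrey_norm p q w x = ennreal B"
  using assms by (cases "morrey_norm p q w x") (auto simp: morrey_space_def)

theorem maximal_op_bounded_if_muckenhoupt:
  assumes p: "1 < p" and q: "p < q" and w: "\<And>k. 0 < w k" and Ap: "w \<in> muckenhoupt p"
  shows "bounded_from_to maximal_op (morrey_space p q w) (morrey_norm p q w)
    (morrey_space p q w) (morrey_norm p q w)"
proof -
  obtain D where D: "muckenhoupt_bound p w D" using Ap muckenhoupt_iff[of w, OF w p] by blast
  have D0: "0 < D" using D by (simp add: muckenhoupt_bound_def)
  obtain K where K: "0 < K" "\<And>f A B. (\<forall>k. 0 \<le> f k) \<Longrightarrow> A \<le> B \<Longrightarrow>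
    (\<Sum>m\<in>{A..B}. imax (\<lambda>_. 1) f {A..B} m powr p * w m) \<le> K * (\<Sum>m\<in>{A..B}. f m powr p * w m)"
    using muckenhoupt_imax_bound[OF p w D] by blast
  define \<theta> where "\<theta> = 1 - p / q"
  have \<theta>: "0 \<le> \<theta>" using p q by (simp add: \<theta>_def)
  \<comment> \<open>The outer \<open>2 powr p\<close> splits a power of a sum; the two terms inside
    are the local part, with doubling applied, and the contribution of the long averages.\<close>
  define E where "E = 2 powr p * (K * (D * 2 powr p) powr \<theta> + 2 powr p * D)"
  have E: "0 < E" using K D0 by (simp add: E_def add_pos_pos)
  have main: "(\<forall>m. maximal_op x m < \<infinity>) \<and>
      morrey_norm p q w (\<lambda>m. enn2real (maximal_op x m)) \<le> ennreal (E powr (1 / p) * B)"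
    if B: "0 \<le> B" and norm: "morrey_norm p q w x = ennreal B" for x B
  proof
    have nle: "morrey_norm p q w x \<le> ennreal B" using norm by simp
    note M_le = maximal_op_le[OF p q w D B nle]
    show fin: "\<forall>m. maximal_op x m < \<infinity>"
    proof
      fix m
      have "m \<in> symm_interval m 0" by (simp add: symm_interval_eq)
      then show "maximal_op x m < \<infinity>"
        using M_le[of m m 0] by (metis ennreal_less_top infinity_ennreal_def le_less_trans)
    qed
    define y where "y m = enn2real (maximal_op x m)" for m
    have "(\<Sum>k\<in>symm_interval a N. \<bar>y k\<bar> powr p * w k)
        \<le> (E powr (1 / p) * B) powr p * (\<Sum>k\<in>symm_interval a N. w k) powr (1 - p / q)" for a N
    proof -
      let ?S = "symm_interval a N" and ?W = "symm_interval a (2 * N)"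
      define V where "V = (\<Sum>k\<in>?S. w k)"
      define I where "I = imax (\<lambda>_. 1) (\<lambda>k. \<bar>x k\<bar>) ?W"
      define c where "c = 2 * D powr (1 / p) * B * V powr (- 1 / q)"
      have V: "0 < V" unfolding V_def using w by (intro sum_pos) (auto simp: symm_interval_eq)
      have c: "0 \<le> c" using B by (simp add: c_def)
      have SW: "?S \<subseteq> ?W" by (auto simp: symm_interval_eq)
      have I0: "0 \<le> I m" if "m \<in> ?W" for m
        unfolding I_def using that by (intro imax_nonneg) (auto simp: symm_interval_eq)
      have y: "\<bar>y m\<bar> powr p \<le> 2 powr p * (I m powr p + c powr p)" if m: "m \<in> ?S" for m
      proof -
        have Im: "0 \<le> I m" using I0 m SW by blast
        have "y m \<le> enn2real (ennreal (I m + c))"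
          unfolding y_def using M_le[OF m] by (intro enn2real_mono) (auto simp: I_def c_def V_def)
        then have "\<bar>y m\<bar> \<le> I m + c" using Im c by (simp add: y_def del: ennreal_plus)
        then have "\<bar>y m\<bar> powr p \<le> (I m + c) powr p" using p by (intro powr_mono2) auto
        also have "\<dots> \<le> 2 powr p * (I m powr p + c powr p)"
          using p Im c by (intro powr_add_le) auto
        finally show ?thesis .
      qed
      \<comment> \<open>The long averages are bounded by a constant on \<open>?S\<close>; its mass
        \<open>V\<close> times \<open>V powr (- p / q)\<close> is exactly the Morrey scaling
        \<open>V powr \<theta>\<close>.\<close>
      have cp: "c powr p * V = 2 powr p * D * (B powr p * V powr \<theta>)"
      proof -
        define v where "v = V powr (- 1 / q)"
        have "v powr p * V = V powr \<theta>"
          using V unfolding v_def powr_powr by (simp add: \<theta>_def powr_diff powr_minus_divide)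
        moreover have "c powr p = 2 powr p * D * (B powr p * v powr p)"
          using p B D0 unfolding c_def v_def[symmetric] by (simp add: powr_mult powr_powr v_def)
        ultimately show ?thesis by (metis mult.assoc)
      qed
      have "(\<Sum>k\<in>?S. I k powr p * w k) \<le> (\<Sum>k\<in>?W. I k powr p * w k)"
        using SW w by (intro sum_mono2) (auto simp: symm_interval_eq less_imp_le)
      also have "\<dots> \<le> K * (\<Sum>k\<in>?W. \<bar>x k\<bar> powr p * w k)"
        unfolding I_def symm_interval_eq by (intro K(2)) auto
      also have "\<dots> \<le> K * (B powr p * (\<Sum>k\<in>?W. w k) powr \<theta>)"
        using nle p q w B K unfolding \<theta>_def
        by (intro mult_left_mono) (auto simp: morrey_norm_le_iff)
      \<comment> \<open>Doubling returns from the mass of \<open>?W\<close> to that of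
        \<open>?S\<close>, monotonically because \<theta> is nonnegative.\<close>
      also have "\<dots> \<le> K * (B powr p * (D * 2 powr p * V) powr \<theta>)"
        unfolding V_def using K \<theta> w
        by (intro mult_left_mono powr_mono2 sum_nonneg muckenhoupt_doubling[OF p w D]
              symm_interval_mem_intervals SW) (auto simp: card_symm_interval less_imp_le)
      also have "\<dots> = K * (D * 2 powr p) powr \<theta> * (B powr p * V powr \<theta>)"
        using D0 V by (simp add: powr_mult mult_ac)
      finally have I: "(\<Sum>k\<in>?S. I k powr p * w k) \<le> K * (D * 2 powr p) powr \<theta> * (B powr p * V powr \<theta>)" .
      have "(\<Sum>k\<in>?S. \<bar>y k\<bar> powr p * w k) \<le> (\<Sum>k\<in>?S. 2 powr p * (I k powr p + c powr p) * w k)"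
        using y w by (intro sum_mono mult_right_mono) (auto intro: less_imp_le)
      also have "\<dots> = 2 powr p * ((\<Sum>k\<in>?S. I k powr p * w k) + c powr p * V)"
        unfolding V_def sum_distrib_left sum.distrib[symmetric]
        by (intro sum.cong) (simp_all add: algebra_simps)
      also have "\<dots> \<le> 2 powr p * (K * (D * 2 powr p) powr \<theta> * (B powr p * V powr \<theta>)
          + 2 powr p * D * (B powr p * V powr \<theta>))"
        unfolding cp using I by (intro mult_left_mono add_right_mono) auto
      also have "\<dots> = E * B powr p * V powr \<theta>"
        by (simp add: E_def algebra_simps)
      also have "E * B powr p = (E powr (1 / p) * B) powr p"
        using E B p by (simp add: powr_mult powr_powr)
      finally show ?thesis by (simp add: V_def \<theta>_def)
    qed
    then show "morrey_norm p q w (\<lambda>m. enn2real (maximal_op x m)) \<le> ennreal (E powr (1 / p) * B)"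
      using p q w B by (subst morrey_norm_le_iff) (auto simp: y_def)
  qed
  show ?thesis
    unfolding bounded_from_to_def
  proof (intro exI[of _ "E powr (1 / p)"] conjI ballI)
    fix x assume "x \<in> morrey_space p q w"
    then obtain B where B: "0 \<le> B" "morrey_norm p q w x = ennreal B" by (rule morrey_spaceE)
    note main = main[OF B]
    show "\<forall>m. maximal_op x m < \<infinity>" using main by blast
    show "morrey_norm p q w (\<lambda>m. enn2real (maximal_op x m)) \<le> ennreal (E powr (1 / p)) * morrey_norm p q w x"
      using main B by (simp add: ennreal_mult)
    show "(\<lambda>m. enn2real (maximal_op x m)) \<in> morrey_space p q w"
      using main le_less_trans[OF _ ennreal_less_top] by (auto simp: morrey_space_def)
  qed (use E in simp_all)
qed

section \<open>Necessity of the A_q condition\<close>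

lemma maximal_op_ge:
  "ennreal (1 / real (card (symm_interval m N)) * (\<Sum>k\<in>symm_interval m N. \<bar>x k\<bar>)) \<le> maximal_op x m"
  unfolding maximal_op_def by (rule SUP_upper) simp

text \<open>Jensen's inequality with exponent \<open>q / p\<close> on each window produces precisely
  the power of the window's mass that the Morrey norm compensates.\<close>

lemma morrey_norm_le_weighted_norm:
  assumes p: "0 < p" and q: "p < q" and w: "\<And>k. 0 < w k" and J: "finite J"
    and x: "\<And>k. k \<notin> J \<Longrightarrow> x k = 0"
  shows "morrey_norm p q w x \<le> ennreal ((\<Sum>k\<in>J. \<bar>x k\<bar> powr q * w k) powr (1 / q))"
proof -
  define G where "G = (\<Sum>k\<in>J. \<bar>x k\<bar> powr q * w k)"
  have q0: "0 < q" using p q by simp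
  have G: "0 \<le> G" unfolding G_def using w by (intro sum_nonneg) (simp add: less_imp_le)
  have "(\<Sum>k\<in>symm_interval m N. \<bar>x k\<bar> powr p * w k)
      \<le> (G powr (1 / q)) powr p * (\<Sum>k\<in>symm_interval m N. w k) powr (1 - p / q)" for m N
  proof -
    let ?S = "symm_interval m N"
    define V where "V = (\<Sum>k\<in>?S. w k)"
    define X where "X = (\<Sum>k\<in>?S. \<bar>x k\<bar> powr p * w k)"
    have S: "finite ?S" "?S \<noteq> {}" by (auto simp: symm_interval_eq)
    have V: "0 < V" unfolding V_def using S w by (intro sum_pos) auto
    have X: "0 \<le> X" unfolding X_def using w by (intro sum_nonneg) (simp add: less_imp_le)
    have "X powr (q / p) \<le> V powr (q / p - 1) * (\<Sum>k\<in>?S. (\<bar>x k\<bar> powr p) powr (q / p) * w k)"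
      unfolding X_def V_def using p q S w by (intro powr_sum_le_sum_powr) auto
    also have "(\<Sum>k\<in>?S. (\<bar>x k\<bar> powr p) powr (q / p) * w k) = (\<Sum>k\<in>?S. \<bar>x k\<bar> powr q * w k)"
      using p by (simp add: powr_powr)
    also have "\<dots> = (\<Sum>k\<in>?S \<inter> J. \<bar>x k\<bar> powr q * w k)"
      using S x by (intro sum.mono_neutral_right) auto
    also have "\<dots> \<le> G"
      unfolding G_def using J w by (intro sum_mono2) (auto simp: less_imp_le)
    finally have "X powr (q / p) \<le> V powr (q / p - 1) * G" using V by simp
    then have "(X powr (q / p)) powr (p / q) \<le> (V powr (q / p - 1) * G) powr (p / q)"
      using p q0 by (intro powr_mono2) auto
    also have "\<dots> = (V powr (q / p - 1)) powr (p / q) * G powr (p / q)"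
      using G by (simp add: powr_mult)
    also have "(V powr (q / p - 1)) powr (p / q) = V powr (1 - p / q)"
    proof -
      have "(q / p - 1) * (p / q) = 1 - p / q" using p q0 by (simp add: field_simps)
      then show ?thesis by (simp add: powr_powr)
    qed
    finally show ?thesis
      unfolding X_def[symmetric] V_def[symmetric] using p q0 X by (simp add: powr_powr mult.commute)
  qed
  then show ?thesis
    unfolding G_def[symmetric] using p q0 w by (subst morrey_norm_le_iff) auto
qed

theorem muckenhoupt_if_maximal_op_bounded:
  assumes p: "1 < p" and q: "p < q" and w: "\<And>k. 0 < w k"
    and bdd: "bounded_from_to maximal_op (morrey_space p q w) (morrey_norm p q w)
      (morrey_space p q w) (morrey_norm p q w)"
  shows "w \<in> muckenhoupt q"
proof -
  let ?s = "dual_weight q w"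
  have q1: "1 < q" using p q by simp
  have s: "0 < ?s k" for k using dual_weight_pos[OF w] .
  obtain C where C: "0 < C" and bd: "\<And>x. x \<in> morrey_space p q w \<Longrightarrow> (\<forall>m. maximal_op x m < \<infinity>) \<and>
      morrey_norm p q w (\<lambda>m. enn2real (maximal_op x m)) \<le> ennreal C * morrey_norm p q w x"
    using bdd unfolding bounded_from_to_def by blast
  \<comment> \<open>Symmetric intervals come first because the Morrey norm sees only these.\<close>
  have centred: "(\<Sum>k\<in>J. w k) * (\<Sum>k\<in>J. ?s k) powr (q - 1) \<le> (2 * C) powr q * real (card J) powr q"
    if J: "J = symm_interval a N" for J a N
  proof -
    define V where "V = (\<Sum>k\<in>J. w k)"
    define Z where "Z = (\<Sum>k\<in>J. ?s k)"
    define n where "n = real (card J)"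
    \<comment> \<open>The extremal test sequence: the identity \<open>?s powr q * w = ?s\<close>
      makes the \<open>q\<close>-th power sum of \<open>x\<close> equal to \<open>Z\<close>.\<close>
    define x where "x k = (if k \<in> J then ?s k else 0)" for k
    have fJ: "finite J" "J \<noteq> {}" by (auto simp: J symm_interval_eq)
    have n: "0 < n" using fJ by (simp add: n_def card_gt_0_iff)
    have V: "0 < V" and Z: "0 < Z" unfolding V_def Z_def using fJ w s by (auto intro!: sum_pos)
    have "?s k powr q * w k = ?s k" for k
      using dual_weight_powr[of w k q "?s k"] w[of k] s[of k] q1 by simp
    then have "(\<Sum>k\<in>J. \<bar>x k\<bar> powr q * w k) = Z"
      by (simp add: Z_def x_def)
    then have xn: "morrey_norm p q w x \<le> ennreal (Z powr (1 / q))"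
      using morrey_norm_le_weighted_norm[of p q w J x] p q w fJ by (simp add: x_def)
    then have xin: "x \<in> morrey_space p q w"
      using le_less_trans[OF _ ennreal_less_top] by (auto simp: morrey_space_def)
    define y where "y m = enn2real (maximal_op x m)" for m
    have "morrey_norm p q w y \<le> ennreal C * morrey_norm p q w x"
      unfolding y_def using bd[OF xin] by blast
    also have "\<dots> \<le> ennreal C * ennreal (Z powr (1 / q))"
      using xn by (intro mult_left_mono) auto
    also have "\<dots> = ennreal (C * Z powr (1 / q))" using C by (simp add: ennreal_mult)
    finally have "morrey_norm p q w y \<le> ennreal (C * Z powr (1 / q))" .
    then have up: "(\<Sum>k\<in>J. \<bar>y k\<bar> powr p * w k) \<le> (C * Z powr (1 / q)) powr p * V powr (1 - p / q)"
      using p q w C unfolding V_def J by (subst (asm) morrey_norm_le_iff) auto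
    have y: "Z / (2 * n) \<le> y m" if m: "m \<in> J" for m
    proof -
      \<comment> \<open>Radius \<open>2 * N\<close> around any \<open>m\<close> in \<open>J\<close>
        covers \<open>J\<close>, and \<open>4 * N + 1 \<le> 2 * n\<close>.\<close>
      let ?L = "symm_interval m (2 * N)"
      have JL: "J \<subseteq> ?L" using m by (auto simp: J symm_interval_eq)
      have "(\<Sum>k\<in>?L. \<bar>x k\<bar>) = Z"
        unfolding Z_def using JL s
        by (intro sum.mono_neutral_cong_right) (auto simp: x_def symm_interval_eq)
      then have "ennreal (1 / real (card ?L) * Z) \<le> maximal_op x m"
        using maximal_op_ge[of m "2 * N" x] by simp
      moreover have "maximal_op x m < \<infinity>" using bd[OF xin] by blast
      ultimately have "1 / real (card ?L) * Z \<le> y m"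
        unfolding y_def using enn2real_mono[of "ennreal (1 / real (card ?L) * Z)" "maximal_op x m"] Z by simp
      moreover have "Z / (2 * n) \<le> 1 / real (card ?L) * Z"
        using Z by (simp add: n_def J card_symm_interval frac_le)
      ultimately show ?thesis by linarith
    qed
    have "(Z / (2 * n)) powr p * V = (\<Sum>k\<in>J. (Z / (2 * n)) powr p * w k)"
      by (simp add: V_def sum_distrib_left)
    also have "\<dots> \<le> (\<Sum>k\<in>J. \<bar>y k\<bar> powr p * w k)"
    proof (intro sum_mono mult_right_mono powr_mono2)
      show "Z / (2 * n) \<le> \<bar>y k\<bar>" if "k \<in> J" for k using y[OF that] by linarith
    qed (use p w Z n in \<open>auto simp: less_imp_le\<close>)
    also note up
    also have "(C * Z powr (1 / q)) powr p * V powr (1 - p / q) = (C powr p * Z powr (p / q) / V powr (p / q)) * V"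
      using C V by (simp add: powr_mult powr_powr powr_diff)
    finally have "(Z / (2 * n)) powr p * V powr (p / q) \<le> C powr p * Z powr (p / q)"
      using V by (simp add: pos_le_divide_eq)
    \<comment> \<open>The power \<open>q / p\<close> removes \<open>p\<close> altogether, so only
      the A_q exponents remain.\<close>
    then have "((Z / (2 * n)) powr p * V powr (p / q)) powr (q / p) \<le> (C powr p * Z powr (p / q)) powr (q / p)"
      using p q by (intro powr_mono2) auto
    then have "(Z / (2 * n)) powr q * V \<le> C powr q * Z"
      using p q C V Z n by (simp add: powr_mult powr_powr)
    then have "Z powr q * V \<le> ((2 * C) powr q * n powr q) * Z"
      using n Z C by (simp add: powr_divide powr_mult pos_divide_le_eq mult_ac)
    moreover have "Z powr q = Z powr (q - 1) * Z" using Z by (simp add: powr_diff)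
    ultimately show ?thesis using Z by (simp add: V_def Z_def n_def mult_ac)
  qed
  have "muckenhoupt_bound q w ((4 * C) powr q)"
    unfolding muckenhoupt_bound_def
  proof (intro conjI ballI)
    fix J assume "J \<in> intervals"
    then obtain a b where J: "J = {a..b}" "a \<le> b" by (auto simp: intervals_def)
    \<comment> \<open>Centring at the left endpoint at most doubles the cardinality, which turns
      \<open>2 * C\<close> into \<open>4 * C\<close>.\<close>
    define J' where "J' = symm_interval a (nat (b - a))"
    have sub: "J \<subseteq> J'" and fin: "finite J'" and cd: "card J' \<le> 2 * card J"
      using J by (auto simp: J'_def symm_interval_eq)
    have "(\<Sum>k\<in>J. w k) * (\<Sum>k\<in>J. ?s k) powr (q - 1) \<le> (\<Sum>k\<in>J'. w k) * (\<Sum>k\<in>J'. ?s k) powr (q - 1)"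
      using sub fin w q1
      by (intro mult_mono powr_mono2 sum_mono2 sum_nonneg) (auto simp: less_imp_le)
    also have "\<dots> \<le> (2 * C) powr q * real (card J') powr q"
      using J'_def by (rule centred)
    also have "\<dots> \<le> (2 * C) powr q * (2 * real (card J)) powr q"
      using cd q1 by (intro mult_left_mono powr_mono2) auto
    also have "\<dots> = (4 * C) powr q * real (card J) powr q"
      using C by (simp flip: powr_mult add: mult_ac)
    finally show "(\<Sum>k\<in>J. w k) * (\<Sum>k\<in>J. ?s k) powr (q - 1) \<le> (4 * C) powr q * real (card J) powr q" .
  qed (use C in simp)
  then show ?thesis using muckenhoupt_iff[of w, OF w q1] by blast
qed

theorem theorem4p6:
  fixes p q :: real and \<omega> :: "int \<Rightarrow> real"
  assumes "1 < p" and "p < q" and "discrete_weight \<omega>"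
  shows "(\<omega> \<in> muckenhoupt p \<longrightarrow>
            bounded_from_to maximal_op
              (morrey_space p q \<omega>) (morrey_norm p q \<omega>)
              (morrey_space p q \<omega>) (morrey_norm p q \<omega>)) \<and>
         (bounded_from_to maximal_op
              (morrey_space p q \<omega>) (morrey_norm p q \<omega>)
              (morrey_space p q \<omega>) (morrey_norm p q \<omega>) \<longrightarrow>
            \<omega> \<in> muckenhoupt q)"
  using assms maximal_op_bounded_if_muckenhoupt muckenhoupt_if_maximal_op_bounded
  by (auto simp: discrete_weight_def)

end
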